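(* Let $n,\mu\in\mathbb{N}_0$ and $m\in\mathbb{N}$. Let $(c_j)_{j\ge 0}$ be the Cauchy numbers, let $s(\cdot,\cdot)$ and $S(\cdot,\cdot)$ be the Stirling numbers of the first and second kind, respectively, let $(\theta)_j$ be the descending factorial, and let $$\rho_m(\theta)=\frac{1}{(m-1)!}\sum_{k=0}^{m-1}\binom{m}{k}(-1)^k(\theta-k)_+^{m-1},\qquad \theta\in[0,m].$$ Then $$\sum_{\substack{l_1+\cdots+l_m=\mu\\ l_1,\ldots,l_m\ge 0}}\binom{\mu}{l_1,\ldots,l_m}\sum_{\substack{k_1+\cdots+k_m=n\\ k_1,\ldots,k_m\ge 0}}\binom{n}{k_1,\ldots,k_m}\,c_{k_1+l_1}\cdots c_{k_m+l_m}=\int_0^m(\theta)_{\mu+n}\,\rho_m(\theta)\,d\theta=\sum_{k=0}^{\mu+n}\frac{s(\mu+n,k)\,S(m+k,m)}{\binom{m+k}{m}}.$$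
   Context: $\mathbb{N}$ is the set of positive integers and $\mathbb{N}_0=\mathbb{N}\cup\{0\}$. Descending factorial: $(\theta)_0=1$ and $(\theta)_j=\theta(\theta-1)\cdots(\theta-j+1)$ for $j\ge 1$. The Cauchy numbers $(c_j)_{j\ge0}$ are defined by the generating function $\frac{z}{\log(1+z)}=\sum_{j=0}^\infty c_j\frac{z^j}{j!}$ for $z\in\mathbb{C}$, $|z|<1$, or equivalently by $c_j=\int_0^1(\theta)_j\,d\theta$, $j\in\mathbb{N}_0$. The Stirling numbers of the first kind $s(j,k)$ and of the second kind $S(j,k)$, $k=0,1,\ldots,j$, are defined by $(x)_j=\sum_{k=0}^j s(j,k)x^k$ and $x^j=\sum_{k=0}^j S(j,k)(x)_k$ for $x\in\mathbb{R}$. $x_+=\max(x,0)$; for $m=1$ the power $(\theta-k)_+^{0}$ with $k=0$ is taken to be $1$, so that $\rho_1(\theta)=1$ on $[0,1]$. The multinomial coefficient is $\binom{n}{k_1,\ldots,k_m}=\frac{n!}{k_1!\cdots k_m!}$ for $k_1,\ldots,k_m\in\mathbb{N}_0$ with $k_1+\cdots+k_m=n$. All sums run over tuples of nonnegative integers. *)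

theory Defs
  imports
    "HOL-Analysis.Analysis"
    "HOL-Computational_Algebra.Polynomial"
    "HOL-Combinatorics.Stirling"
begin

definition desc_fact :: "'a::comm_ring_1 \<Rightarrow> nat \<Rightarrow> 'a" where
  "desc_fact x j = (\<Prod>i<j. x - of_nat i)"

lemma desc_fact_0 [simp]: "desc_fact x 0 = 1"
  by (simp add: desc_fact_def)

lemma desc_fact_Suc: "desc_fact x (Suc j) = desc_fact x j * (x - of_nat j)"
  by (simp add: desc_fact_def)

lemma desc_fact_gbinomial:
  fixes x :: "'a::field_char_0"
  shows "desc_fact x j = fact j * (x gchoose j)"
  by (simp add: desc_fact_def gbinomial_prod_rev atLeast0LessThan)

text \<open>
  Signed Stirling numbers of the first kind: the coefficients of the descending factorial
  viewed as a polynomial in its argument.  (The library constant \<open>stirling\<close> is the unsigned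
  version; \<open>Stirling\<close> is the second kind and is used as it stands, see
  \<open>power_eq_sum_Stirling\<close>.)
\<close>

definition stirling1 :: "nat \<Rightarrow> nat \<Rightarrow> int" where
  "stirling1 j k = coeff (desc_fact [:0, 1:] j) k"

lemma degree_desc_fact: "degree (desc_fact [:0, 1:] j :: int poly) \<le> j"
proof (induction j)
  case (Suc j)
  have eq: "[:0, 1:] - of_nat j = [:- int j, 1:]"
    by (simp add: of_nat_poly)
  have "degree (desc_fact [:0, 1:] (Suc j) :: int poly)
      \<le> degree (desc_fact [:0, 1:] j :: int poly) + degree [:- int j, 1:]"
    unfolding desc_fact_Suc eq by (rule degree_mult_le)
  then show ?case using Suc by simp
qed simp

lemma desc_fact_eq_sum_stirling1:
  fixes x :: real
  shows "desc_fact x j = (\<Sum>k=0..j. of_int (stirling1 j k) * x ^ k)"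
proof -
  let ?p = "desc_fact [:0, 1:] j :: int poly"
  have "desc_fact x j = poly (map_poly of_int ?p) x"
  proof (induction j)
    case (Suc j)
    have eq: "[:0, 1:] - of_nat j = [:- int j, 1:]"
      by (simp add: of_nat_poly)
    have hom: "map_poly (of_int :: int \<Rightarrow> real) (p * [:- int j, 1:])
        = map_poly of_int p * [:- of_nat j, 1:]" for p
      by (rule poly_eqI) (simp add: coeff_map_poly coeff_pCons split: nat.splits)
    show ?case
      unfolding desc_fact_Suc eq hom poly_mult Suc [symmetric] by simp
  qed simp
  also have "\<dots> = (\<Sum>k\<le>j. coeff (map_poly of_int ?p) k * x ^ k)"
    unfolding poly_altdef
  proof (rule sum.mono_neutral_left)
    show "{..degree (map_poly (of_int :: int \<Rightarrow> real) ?p)} \<subseteq> {..j}"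
      using map_poly_degree_leq [of "of_int :: int \<Rightarrow> real" ?p] degree_desc_fact [of j] by auto
  qed (auto simp: coeff_eq_0)
  finally show ?thesis
    by (simp add: coeff_map_poly stirling1_def atLeast0AtMost)
qed

lemma power_eq_sum_Stirling:
  fixes x :: real
  shows "x ^ j = (\<Sum>k=0..j. of_nat (Stirling j k) * desc_fact x k)"
  unfolding atLeast0AtMost
proof (induction j)
  case (Suc j)
  have "x ^ Suc j = (\<Sum>k\<le>j. of_nat (Stirling j k) * (x * desc_fact x k))"
    by (simp add: Suc sum_distrib_left mult_ac)
  also have "\<dots> = (\<Sum>k\<le>j. of_nat (Stirling j k) * desc_fact x (Suc k))
      + (\<Sum>k\<le>j. of_nat k * of_nat (Stirling j k) * desc_fact x k)"
    by (simp add: desc_fact_Suc algebra_simps sum.distrib [symmetric])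
  also have "(\<Sum>k\<le>j. of_nat k * of_nat (Stirling j k) * desc_fact x k)
      = (\<Sum>k\<le>Suc j. of_nat k * of_nat (Stirling j k) * desc_fact x k)"
    by simp
  also have "\<dots> = (\<Sum>k\<le>j. of_nat (Suc k) * of_nat (Stirling j (Suc k)) * desc_fact x (Suc k))"
    by (subst sum.atMost_Suc_shift) simp
  also have "(\<Sum>k\<le>j. of_nat (Stirling j k) * desc_fact x (Suc k)) + \<dots>
      = (\<Sum>k\<le>Suc j. of_nat (Stirling (Suc j) k) * desc_fact x k)"
    using sum.atMost_Suc_shift [of "\<lambda>k. of_nat (Stirling (Suc j) k) * desc_fact x k" j]
    by (simp add: algebra_simps sum.distrib del: sum.atMost_Suc)
  finally show ?case .
qed simp

definition cauchy_number :: "nat \<Rightarrow> real" where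
  "cauchy_number j = integral {0..1} (\<lambda>\<theta>. desc_fact \<theta> j)"

lemma continuous_on_desc_fact [continuous_intros]:
  "continuous_on A (\<lambda>\<theta>::real. desc_fact \<theta> j)"
  unfolding desc_fact_def by (intro continuous_intros)

lemma abs_desc_fact_le:
  assumes "0 \<le> \<theta>" "\<theta> \<le> (1::real)"
  shows "\<bar>desc_fact \<theta> j\<bar> \<le> fact j"
proof (induction j)
  case (Suc j)
  have "\<bar>desc_fact \<theta> j\<bar> * \<bar>\<theta> - of_nat j\<bar> \<le> fact j * of_nat (Suc j)"
    using assms by (intro mult_mono Suc) auto
  then show ?case
    by (simp add: desc_fact_Suc abs_mult mult_ac)
qed simp

text \<open>The generating function of the Cauchy numbers; at \<open>z = 0\<close> the quotient is read as \<open>1\<close>.\<close>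

lemma cauchy_number_sums:
  fixes z :: complex
  assumes z: "norm z < 1"
  shows "(\<lambda>j. of_real (cauchy_number j) * z ^ j / fact j)
           sums (if z = 0 then 1 else z / Ln (1 + z))"
proof (cases "z = 0")
  case True
  have "(\<lambda>j. of_real (cauchy_number j) * z ^ j / fact j) sums
      (of_real (cauchy_number 0) * z ^ 0 / fact 0)"
    using sums_finite [of "{0}" "\<lambda>j. of_real (cauchy_number j) * z ^ j / fact j"] True
    by simp
  then show ?thesis using True by (simp add: cauchy_number_def)
next
  case False
  define L where "L = Ln (1 + z)"
  have nz: "1 + z \<noteq> 0"
    using z by (metis add_eq_0_iff norm_minus_cancel norm_one less_irrefl)
  have eL: "exp L = 1 + z"
    using nz by (simp add: L_def)
  have L0: "L \<noteq> 0"
    using eL False by auto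
  define f where "f = (\<lambda>j (\<theta>::real). of_real (desc_fact \<theta> j) * (z ^ j / fact j))"
  have sums: "(\<lambda>j. f j \<theta>) sums exp (of_real \<theta> * L)" for \<theta>
  proof -
    have "(\<lambda>j. (of_real \<theta> gchoose j) * z ^ j) sums (1 + z) powr (of_real \<theta>)"
      using gen_binomial_complex [OF z, of "of_real \<theta>"] by simp
    moreover have "of_real (desc_fact \<theta> j) = (fact j * (of_real \<theta> gchoose j) :: complex)" for j
      by (simp add: desc_fact_gbinomial [symmetric]) (simp add: desc_fact_def)
    ultimately show ?thesis
      using nz by (simp add: f_def powr_def L_def)
  qed
  have "uniform_limit {0..1} (\<lambda>n \<theta>. \<Sum>j<n. f j \<theta>) (\<lambda>\<theta>. \<Sum>j. f j \<theta>) sequentially"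
  proof (rule Weierstrass_m_test [where M = "\<lambda>j. norm z ^ j"])
    fix j \<theta> assume "\<theta> \<in> {0..1::real}"
    then have "\<bar>desc_fact \<theta> j\<bar> * (norm z ^ j / fact j) \<le> fact j * (norm z ^ j / fact j)"
      by (intro mult_right_mono abs_desc_fact_le) auto
    then show "norm (f j \<theta>) \<le> norm z ^ j"
      by (simp add: f_def norm_mult norm_divide norm_power)
  qed (use z in simp)
  then have ul: "uniform_limit {0..1} (\<lambda>n \<theta>. \<Sum>j<n. f j \<theta>) (\<lambda>\<theta>. exp (of_real \<theta> * L)) sequentially"
    using sums [THEN sums_unique] by simp
  have int: "(f j has_integral of_real (cauchy_number j) * (z ^ j / fact j)) {0..1}" for j
  proof -
    have "((\<lambda>\<theta>. desc_fact \<theta> j) has_integral cauchy_number j) {0..1}"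
      unfolding cauchy_number_def
      by (intro integrable_integral integrable_continuous_interval continuous_intros)
    then have "((\<lambda>\<theta>. of_real (desc_fact \<theta> j) :: complex) has_integral of_real (cauchy_number j)) {0..1}"
      by (rule has_integral_of_real)
    then show ?thesis
      unfolding f_def by (rule has_integral_mult_left)
  qed
  have "continuous_on {0..1} (f j)" for j
    unfolding f_def by (intro continuous_intros)
  then have cont: "continuous_on {0..1} (\<lambda>\<theta>. \<Sum>j<n. f j \<theta>)" for n
    by (intro continuous_intros)
  obtain I J where IJ: "\<And>n. ((\<lambda>\<theta>. \<Sum>j<n. f j \<theta>) has_integral I n) {0..1}"
      "((\<lambda>\<theta>. exp (of_real \<theta> * L)) has_integral J) {0..1}" "I \<longlonglongrightarrow> J"
    by (rule uniform_limit_integral [OF ul cont]) auto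
  have "I = (\<lambda>n. \<Sum>j<n. of_real (cauchy_number j) * (z ^ j / fact j))"
    by (intro ext has_integral_unique [OF IJ(1)] has_integral_sum int) auto
  with IJ(3) have "(\<lambda>j. of_real (cauchy_number j) * (z ^ j / fact j)) sums J"
    by (simp add: sums_def)
  moreover have "J = z / L"
  proof -
    have "((\<lambda>\<theta>. exp (of_real \<theta> * L)) has_integral
        (exp (of_real 1 * L) / L - exp (of_real 0 * L) / L)) {0..1}"
    proof (rule fundamental_theorem_of_calculus)
      fix x :: real
      have "((\<lambda>w. exp (w * L) / L) has_field_derivative exp (of_real x * L)) (at (of_real x))"
        using L0 by (auto intro!: derivative_eq_intros)
      then show "((\<lambda>\<theta>. exp (of_real \<theta> * L) / L) has_vector_derivative exp (of_real x * L))
          (at x within {0..1})"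
        by (rule has_vector_derivative_real_field [THEN has_vector_derivative_at_within])
    qed simp
    then have "((\<lambda>\<theta>. exp (of_real \<theta> * L)) has_integral z / L) {0..1}"
      by (simp add: eL diff_divide_distrib [symmetric])
    with IJ(2) show ?thesis by (rule has_integral_unique)
  qed
  ultimately show ?thesis
    using False by (simp add: L_def)
qed

text \<open>For \<open>m = 1\<close> the convention \<open>0 ^ 0 = 1\<close> yields \<open>rho 1 \<theta> = 1\<close> for all \<open>\<theta>\<close>.\<close>

definition rho :: "nat \<Rightarrow> real \<Rightarrow> real" where
  "rho m \<theta> = 1 / fact (m - 1) *
     (\<Sum>k=0..m - 1. real (m choose k) * (- 1) ^ k * max (\<theta> - real k) 0 ^ (m - 1))"

lemma integrable_desc_fact_rho:
  "(\<lambda>\<theta>. desc_fact \<theta> j * rho m \<theta>) integrable_on {a..b}"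
  unfolding rho_def by (intro integrable_continuous_interval continuous_intros)

text \<open>The \<open>m\<close>-tuples of natural numbers with sum \<open>n\<close>, as extensional functions on \<open>{1..m}\<close>.\<close>

definition tuples :: "nat \<Rightarrow> nat \<Rightarrow> (nat \<Rightarrow> nat) set" where
  "tuples m n = {k \<in> {1..m} \<rightarrow>\<^sub>E UNIV. (\<Sum>i=1..m. k i) = n}"

lemma finite_tuples: "finite (tuples m n)"
proof (rule finite_subset)
  show "tuples m n \<subseteq> {1..m} \<rightarrow>\<^sub>E {..n}"
    proof
    fix k assume k: "k \<in> tuples m n"
    have "k i \<le> n" if "i \<in> {1..m}" for i
      using k member_le_sum [of i "{1..m}" k] that by (auto simp: tuples_def)
    with k show "k \<in> {1..m} \<rightarrow>\<^sub>E {..n}"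
      by (auto simp: tuples_def PiE_iff)
  qed
qed (intro finite_PiE; simp)

definition multinomial :: "nat \<Rightarrow> nat \<Rightarrow> (nat \<Rightarrow> nat) \<Rightarrow> real" where
  "multinomial m n k = fact n / (\<Prod>i=1..m. fact (k i))"

end

theory Submission
  imports Defs
begin

text \<open>
  Let \<open>P\<close> be an \<open>m\<close>-fold antiderivative of the descending factorial of order \<open>N = \<mu> + n\<close> and let
  \<open>\<Delta>\<close> be the forward difference. All three quantities equal \<open>\<Delta>\<^sup>m P\<close> at \<open>0\<close>.
  For the sum over Stirling numbers, expand the descending factorial into monomials and use
  \<open>\<Delta>\<^sup>m x\<^sup>M = m! S(M, m)\<close> at \<open>0\<close>. For the integral, Taylor's formula for \<open>P\<close> around the right end
  point \<open>m\<close>, evaluated at \<open>k\<close>, turns the \<open>k\<close>-th summand of the density into \<open>P k\<close> up to a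
  polynomial of degree less than \<open>m\<close>, which \<open>\<Delta>\<^sup>m\<close> annihilates. For the sum over Cauchy numbers,
  \<open>\<Delta>\<^sup>m P\<close> arises from the descending factorial by iterating \<open>m\<close> times the integration over
  \<open>[x, x + 1]\<close>, which by Vandermonde is a binomial convolution with the Cauchy numbers.
\<close>

section \<open>Forward differences\<close>

definition fwd_diff :: "(real \<Rightarrow> real) \<Rightarrow> real \<Rightarrow> real" where
  "fwd_diff f x = f (x + 1) - f x"

lemma fwd_diff_funpow_lincomb:
  "(fwd_diff ^^ m) (\<lambda>x. \<Sum>k\<in>A. a k * g k x) = (\<lambda>x. \<Sum>k\<in>A. a k * (fwd_diff ^^ m) (g k) x)"
proof (induction m)
  case (Suc m)
  then show ?case
    by (simp add: fwd_diff_def fun_eq_iff right_diff_distrib sum_subtractf)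
qed simp

text \<open>Pascal's rule with an index shift. It drives both the expansion of iterated differences
  and the merging of two binomial sums.\<close>

lemma sum_binomial_Suc:
  fixes g :: "nat \<Rightarrow> real"
  shows "(\<Sum>a\<le>Suc n. real (Suc n choose a) * g a)
      = (\<Sum>a\<le>n. real (n choose a) * (g a + g (Suc a)))"
proof -
  have "(\<Sum>a\<le>Suc n. real (Suc n choose a) * g a)
      = g 0 + (\<Sum>a\<le>n. real (n choose Suc a) * g (Suc a)) + (\<Sum>a\<le>n. real (n choose a) * g (Suc a))"
    by (subst sum.atMost_Suc_shift) (simp add: algebra_simps sum.distrib)
  also have "g 0 + (\<Sum>a\<le>n. real (n choose Suc a) * g (Suc a))
      = (\<Sum>a\<le>Suc n. real (n choose a) * g a)"
    by (subst sum.atMost_Suc_shift) simp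
  also have "\<dots> = (\<Sum>a\<le>n. real (n choose a) * g a)"
    by (simp add: binomial_eq_0)
  finally show ?thesis
    by (simp add: distrib_left sum.distrib)
qed

lemma fwd_diff_funpow:
  "(fwd_diff ^^ m) f x = (\<Sum>k\<le>m. real (m choose k) * ((- 1) ^ (m - k) * f (x + real k)))"
proof (induction m arbitrary: f)
  case (Suc m)
  have "(fwd_diff ^^ Suc m) f x = (fwd_diff ^^ m) (fwd_diff f) x"
    by (simp add: funpow_swap1)
  \<comment> \<open>The minus sign of the difference raises the exponent to
    \<open>Suc m - k\<close>, and \<open>m - k\<close> is written as \<open>Suc m - Suc k\<close>.
    Both terms then come from one function of \<open>k\<close>, as \<open>sum_binomial_Suc\<close>
    requires.\<close>
  also have "\<dots> = (\<Sum>k\<le>m. real (m choose k) * ((- 1) ^ (Suc m - k) * f (x + real k)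
      + (- 1) ^ (Suc m - Suc k) * f (x + real (Suc k))))"
    unfolding Suc by (intro sum.cong) (auto simp: fwd_diff_def Suc_diff_le algebra_simps)
  finally show ?case
    by (simp only: sum_binomial_Suc)
qed simp

text \<open>The discrete power rule. At \<open>k = 0\<close> the truncated \<open>k - 1\<close> is
  harmless because of the factor \<open>real k\<close>.\<close>

lemma fwd_diff_desc_fact:
  "fwd_diff (\<lambda>x. desc_fact x k) x = real k * desc_fact x (k - 1)"
proof (cases k)
  case (Suc j)
  have "desc_fact (x + 1) (Suc j) = (x + 1) * desc_fact x j"
    unfolding desc_fact_def by (subst prod.lessThan_Suc_shift) simp
  then show ?thesis
    by (simp add: Suc fwd_diff_def desc_fact_Suc algebra_simps)
qed (simp add: fwd_diff_def)

lemma desc_fact_of_nat_eq_0: "k < m \<Longrightarrow> desc_fact (real k) m = 0"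
  unfolding desc_fact_def by (intro prod_zero) auto

lemma fwd_diff_funpow_desc_fact:
  "(fwd_diff ^^ m) (\<lambda>x. desc_fact x k) x = desc_fact (real k) m * desc_fact x (k - m)"
proof (induction m arbitrary: x)
  case (Suc m)
  have "(fwd_diff ^^ Suc m) (\<lambda>x. desc_fact x k) x
      = fwd_diff (\<lambda>x. desc_fact (real k) m * desc_fact x (k - m)) x"
    by (simp add: Suc fwd_diff_def)
  also have "\<dots> = desc_fact (real k) m * fwd_diff (\<lambda>x. desc_fact x (k - m)) x"
    by (simp add: fwd_diff_def right_diff_distrib)
  also have "\<dots> = desc_fact (real k) m * real (k - m) * desc_fact x (k - Suc m)"
    by (simp add: fwd_diff_desc_fact)
  \<comment> \<open>Truncated subtraction does no damage: for \<open>k < m\<close> both sides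
    vanish, since each descending factorial contains the factor 0.\<close>
  also have "desc_fact (real k) m * real (k - m) = desc_fact (real k) (Suc m)"
  proof (cases "m \<le> k")
    case False
    then show ?thesis by (simp add: desc_fact_of_nat_eq_0)
  qed (simp add: desc_fact_Suc of_nat_diff)
  finally show ?case .
qed simp

lemma desc_fact_self: "desc_fact (real m) m = fact m"
  by (simp add: desc_fact_gbinomial flip: binomial_gbinomial)

text \<open>In the expansion into descending factorials only \<open>k = m\<close> survives: for
  \<open>k < m\<close> the factor \<open>desc_fact (real k) m\<close> is 0, for \<open>k > m\<close>
  the factor \<open>desc_fact 0 (k - m)\<close> is 0.\<close>

lemma fwd_diff_funpow_power_at_0:
  "(fwd_diff ^^ m) (\<lambda>x. x ^ M) 0 = fact m * real (Stirling M m)"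
proof -
  have "(fwd_diff ^^ m) (\<lambda>x. x ^ M) 0
      = (\<Sum>k=0..M. real (Stirling M k) * (desc_fact (real k) m * desc_fact 0 (k - m)))"
    unfolding power_eq_sum_Stirling
    by (simp only: fwd_diff_funpow_lincomb fwd_diff_funpow_desc_fact)
  also have "\<dots> = (\<Sum>k=0..M. if k = m then real (Stirling M m) * fact m else 0)"
  proof (intro sum.cong refl)
    fix k
    show "real (Stirling M k) * (desc_fact (real k) m * desc_fact 0 (k - m))
        = (if k = m then real (Stirling M m) * fact m else 0)"
      using desc_fact_of_nat_eq_0 [of k m] desc_fact_of_nat_eq_0 [of 0 "k - m"]
      by (cases k m rule: linorder_cases) (auto simp: desc_fact_self)
  qed
  also have "\<dots> = fact m * real (Stirling M m)"
    by (simp add: Stirling_less)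
  finally show ?thesis .
qed

lemma fwd_diff_funpow_has_real_derivative:
  assumes "\<And>x. (f has_real_derivative f' x) (at x)"
  shows "((fwd_diff ^^ m) f has_real_derivative (fwd_diff ^^ m) f' x) (at x)"
proof (induction m arbitrary: x)
  case (Suc m)
  have "((\<lambda>x. (fwd_diff ^^ m) f (x + 1)) has_real_derivative (fwd_diff ^^ m) f' (x + 1)) (at x)"
    by (rule DERIV_shift [THEN iffD1, OF Suc])
  then show ?case
    using Suc [of x] by (simp add: fwd_diff_def [abs_def] DERIV_diff)
qed (use assms in simp)

section \<open>Iterated antiderivatives\<close>

text \<open>The descending factorial of order \<open>N\<close>, integrated \<open>i\<close> times
  monomial by monomial from 0.\<close>

definition desc_fact_antideriv :: "nat \<Rightarrow> nat \<Rightarrow> real \<Rightarrow> real" where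
  "desc_fact_antideriv N i x =
     (\<Sum>k=0..N. of_int (stirling1 N k) * fact k / fact (k + i) * x ^ (k + i))"

lemma desc_fact_antideriv_0: "desc_fact_antideriv N 0 x = desc_fact x N"
  by (simp add: desc_fact_antideriv_def desc_fact_eq_sum_stirling1)

lemma desc_fact_antideriv_has_real_derivative:
  "(desc_fact_antideriv N (Suc i) has_real_derivative desc_fact_antideriv N i x) (at x within S)"
proof -
  have "(desc_fact_antideriv N (Suc i) has_real_derivative
      (\<Sum>k=0..N. of_int (stirling1 N k) * fact k / fact (k + Suc i) *
        (real (Suc (k + i)) * x ^ (k + i)))) (at x within S)"
    unfolding desc_fact_antideriv_def [abs_def]
    using DERIV_pow [of "Suc (_ + i)"] by (intro DERIV_sum DERIV_cmult) simp
  also have "(\<Sum>k=0..N. of_int (stirling1 N k) * fact k / fact (k + Suc i) *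
        (real (Suc (k + i)) * x ^ (k + i))) = desc_fact_antideriv N i x"
    unfolding desc_fact_antideriv_def by (intro sum.cong) (auto simp del: of_nat_Suc)
  finally show ?thesis .
qed

text \<open>The factor m! from the difference of a power combines with k!/(k+m)! from the
  integration to the reciprocal of the binomial coefficient.\<close>

lemma fwd_diff_funpow_desc_fact_antideriv_at_0:
  "(fwd_diff ^^ m) (desc_fact_antideriv N m) 0
     = (\<Sum>k=0..N. of_int (stirling1 N k) * real (Stirling (m + k) m) / real ((m + k) choose m))"
proof -
  have "(fwd_diff ^^ m) (desc_fact_antideriv N m) 0
      = (\<Sum>k=0..N. of_int (stirling1 N k) * fact k / fact (k + m) *
          (fact m * real (Stirling (k + m) m)))"
    unfolding desc_fact_antideriv_def [abs_def]
    by (simp only: fwd_diff_funpow_lincomb fwd_diff_funpow_power_at_0)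
  also have "\<dots> = (\<Sum>k=0..N. of_int (stirling1 N k) * real (Stirling (m + k) m) /
      real ((m + k) choose m))"
    by (intro sum.cong) (auto simp: binomial_fact add.commute)
  finally show ?thesis .
qed

section \<open>The integral against the density\<close>

text \<open>Taylor's formula for \<open>P m\<close> about \<open>real m\<close>, evaluated at
  \<open>real k\<close>, with integral remainder. The truncated power extends the remainder integral
  from [k, m] to [0, m].\<close>

lemma has_integral_truncated_power_Taylor:
  fixes P :: "nat \<Rightarrow> real \<Rightarrow> real" and k m :: nat
  assumes deriv: "\<And>i x. (P (Suc i) has_real_derivative P i x) (at x)"
    and "0 < m" "k < m"
  shows "((\<lambda>x. P 0 x * max (x - real k) 0 ^ (m - 1) / fact (m - 1)) has_integral
      (- 1) ^ m * (P m (real k)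
        - (\<Sum>i<m. (real m - real k) ^ i / fact i * ((- 1) ^ i * P (m - i) (real m))))) {0..real m}"
    (is "(?f has_integral ?I) _")
proof -
  \<comment> \<open>\<open>Taylor_has_integral\<close> expands about the left end point, so the
    formula is applied to the reflected function \<open>P m (- x)\<close> on [-m, -k];
    \<open>Df i\<close> is its derivative of order \<open>i\<close>.\<close>
  define Df where "Df i x = (- 1) ^ i * P (m - i) (- x)" for i x
  have Df: "(Df i has_vector_derivative Df (Suc i) x) (at x within S)" if "i < m" for i x S
  proof -
    have m: "m - i = Suc (m - Suc i)" using that by simp
    have "((\<lambda>x. P (m - i) (- x)) has_real_derivative P (m - Suc i) (- x) * (- 1)) (at x within S)"
      unfolding m
      by (rule DERIV_chain2 [OF deriv]) (auto intro!: derivative_eq_intros)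
    then have "(Df i has_real_derivative (- 1) ^ i * (P (m - Suc i) (- x) * (- 1))) (at x within S)"
      unfolding Df_def [abs_def] by (rule DERIV_cmult)
    then show ?thesis
      by (simp add: has_real_derivative_iff_has_vector_derivative Df_def)
  qed
  have "((\<lambda>x. ((- real k - x) ^ (m - 1) / fact (m - 1)) *\<^sub>R Df m x) has_integral
      Df 0 (- real k) - (\<Sum>i<m. ((- real k - (- real m)) ^ i / fact i) *\<^sub>R Df i (- real m)))
      {- real m..- real k}"
    by (rule Taylor_has_integral) (use assms Df in auto)
  then have "((\<lambda>x. (x - real k) ^ (m - 1) / fact (m - 1) * ((- 1) ^ m * P 0 x)) has_integral
      P m (real k)
        - (\<Sum>i<m. (real m - real k) ^ i / fact i * ((- 1) ^ i * P (m - i) (real m))))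
      {real k..real m}"
    by (subst has_integral_reflect_real [symmetric]) (simp add: Df_def minus_diff_commute)
  then have "((\<lambda>x. (- 1) ^ m * ((x - real k) ^ (m - 1) / fact (m - 1) * ((- 1) ^ m * P 0 x)))
      has_integral ?I) {real k..real m}"
    by (rule has_integral_mult_right)
  then have right: "(?f has_integral ?I) {real k..real m}"
    by (rule has_integral_eq [rotated]) (auto simp: max_def mult_ac simp flip: power_mult_distrib)
  show ?thesis
  proof (cases "k = 0")
    case False
    \<comment> \<open>Here \<open>0 < k < m\<close>, so the exponent \<open>m - 1\<close> is
      positive and the truncated power really vanishes. The convention \<open>0 ^ 0 = 1\<close> only
      matters for \<open>m = 1\<close>, where \<open>k = 0\<close>.\<close>
    have "(?f has_integral 0) {0..real k}"
      by (rule has_integral_is_0) (use assms False in \<open>auto simp: max_def power_0_left\<close>)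
    then show ?thesis
      using has_integral_combine [OF _ _ _ right, of 0 0] assms by simp
  qed (use right in simp)
qed

text \<open>Reversing the order of summation gives the difference of order \<open>m\<close> at 0 of
  a power with exponent below \<open>m\<close>.\<close>

lemma alternating_binomial_sum_power_eq_0:
  assumes "i < m"
  shows "(\<Sum>k\<le>m. real (m choose k) * (- 1) ^ k * (real m - real k) ^ i) = 0"
proof -
  have "(\<Sum>k\<le>m. real (m choose k) * (- 1) ^ k * (real m - real k) ^ i)
      = (\<Sum>k\<le>m. real (m choose k) * ((- 1) ^ (m - k) * (0 + real k) ^ i))"
    by (subst sum.nat_diff_reindex [symmetric, of _ "Suc m", simplified lessThan_Suc_atMost])
      (auto intro!: sum.cong simp: of_nat_diff binomial_symmetric [symmetric])
  also have "\<dots> = (fwd_diff ^^ m) (\<lambda>x. x ^ i) 0"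
    by (rule fwd_diff_funpow [symmetric])
  also have "\<dots> = 0"
    using assms by (simp add: fwd_diff_funpow_power_at_0 Stirling_less)
  finally show ?thesis .
qed

lemma integral_rho_eq_fwd_diff:
  fixes P :: "nat \<Rightarrow> real \<Rightarrow> real"
  assumes deriv: "\<And>i x. (P (Suc i) has_real_derivative P i x) (at x)" and "0 < m"
  shows "integral {0..real m} (\<lambda>x. P 0 x * rho m x) = (fwd_diff ^^ m) (P m) 0"
proof -
  \<comment> \<open>The Taylor polynomial of \<open>P m\<close> about \<open>real m\<close>; its
    degree is less than \<open>m\<close>, so its alternating binomial sum is 0.\<close>
  define Q where "Q y = (\<Sum>i<m. (real m - y) ^ i / fact i * ((- 1) ^ i * P (m - i) (real m)))" for y
  have "((\<lambda>x. \<Sum>k<m. real (m choose k) * (- 1) ^ k *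
          (P 0 x * max (x - real k) 0 ^ (m - 1) / fact (m - 1))) has_integral
      (\<Sum>k<m. real (m choose k) * (- 1) ^ k * ((- 1) ^ m * (P m (real k) - Q (real k))))) {0..real m}"
    unfolding Q_def
    by (intro has_integral_sum has_integral_mult_right has_integral_truncated_power_Taylor deriv)
      (use assms in auto)
  moreover have "(\<Sum>k<m. real (m choose k) * (- 1) ^ k *
          (P 0 x * max (x - real k) 0 ^ (m - 1) / fact (m - 1))) = P 0 x * rho m x" for x
  proof -
    have "{0..m - 1} = {..<m}" using assms by auto
    then show ?thesis
      by (simp add: rho_def sum_distrib_left mult_ac divide_inverse)
  qed
  moreover have "(\<Sum>k<m. real (m choose k) * (- 1) ^ k * ((- 1) ^ m * (P m (real k) - Q (real k))))
      = (fwd_diff ^^ m) (P m) 0"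
  proof -
    \<comment> \<open>The density has no summand for \<open>k = m\<close>. Since \<open>Q\<close>
      agrees with \<open>P m\<close> at the expansion point, that summand is 0 and can be added to
      complete the difference of order \<open>m\<close>.\<close>
    have Qm: "Q (real m) = P m (real m)"
    proof -
      have "Q (real m) = (\<Sum>i<m. if i = 0 then P m (real m) else 0)"
        unfolding Q_def by (intro sum.cong) auto
      then show ?thesis using assms by simp
    qed
    have "(\<Sum>k\<le>m. real (m choose k) * (- 1) ^ k * Q (real k))
        = (\<Sum>i<m. (\<Sum>k\<le>m. real (m choose k) * (- 1) ^ k * (real m - real k) ^ i) *
            (1 / fact i * ((- 1) ^ i * P (m - i) (real m))))"
      unfolding Q_def sum_distrib_left sum_distrib_right
      by (subst sum.swap) (simp add: mult_ac)
    also have "\<dots> = 0"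
      by (intro sum.neutral) (auto simp: alternating_binomial_sum_power_eq_0)
    finally have Q0: "(\<Sum>k\<le>m. real (m choose k) * (- 1) ^ k * Q (real k)) = 0" .
    have "(\<Sum>k<m. real (m choose k) * (- 1) ^ k * ((- 1) ^ m * (P m (real k) - Q (real k))))
        = (\<Sum>k\<le>m. real (m choose k) * (- 1) ^ k * ((- 1) ^ m * (P m (real k) - Q (real k))))"
      by (simp add: Qm flip: lessThan_Suc_atMost)
    also have "\<dots> = (- 1) ^ m * (\<Sum>k\<le>m. real (m choose k) * (- 1) ^ k * P m (real k))
        - (- 1) ^ m * (\<Sum>k\<le>m. real (m choose k) * (- 1) ^ k * Q (real k))"
      by (simp add: sum_distrib_left right_diff_distrib sum_subtractf mult_ac)
    also have "\<dots> = (- 1) ^ m * (\<Sum>k\<le>m. real (m choose k) * (- 1) ^ k * P m (real k))"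
      unfolding Q0 by simp
    also have "\<dots> = (\<Sum>k\<le>m. real (m choose k) * ((- 1) ^ (m + k) * P m (real k)))"
      by (simp add: sum_distrib_left mult_ac power_add)
    also have "\<dots> = (\<Sum>k\<le>m. real (m choose k) * ((- 1) ^ (m - k) * P m (0 + real k)))"
      by (intro sum.cong) (auto simp: minus_one_power_iff)
    also have "\<dots> = (fwd_diff ^^ m) (P m) 0"
      by (rule fwd_diff_funpow [symmetric])
    finally show ?thesis .
  qed
  ultimately show ?thesis
    by (simp add: integral_unique)
qed

section \<open>Convolutions of Cauchy numbers\<close>

text \<open>The binomial convolution power of order \<open>m\<close> of the Cauchy numbers, that is,
  the coefficients of z^N/N! in the power of order \<open>m\<close> of their generating
  function.\<close>

fun cauchy_conv :: "nat \<Rightarrow> nat \<Rightarrow> real" where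
  "cauchy_conv 0 N = (if N = 0 then 1 else 0)"
| "cauchy_conv (Suc m) N = (\<Sum>j\<le>N. real (N choose j) * (cauchy_number j * cauchy_conv m (N - j)))"

lemma desc_fact_add:
  fixes x y :: real
  shows "desc_fact (x + y) N = (\<Sum>j\<le>N. real (N choose j) * (desc_fact x (N - j) * desc_fact y j))"
proof -
  have "desc_fact (x + y) N = fact N * (\<Sum>j\<le>N. (y gchoose j) * (x gchoose (N - j)))"
    using gbinomial_Vandermonde [of y x N]
    by (simp add: desc_fact_gbinomial atLeast0AtMost add.commute)
  also have "\<dots> = (\<Sum>j\<le>N. real (N choose j) * (desc_fact x (N - j) * desc_fact y j))"
    unfolding sum_distrib_left
    by (intro sum.cong) (auto simp: desc_fact_gbinomial binomial_fact)
  finally show ?thesis .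
qed

lemma has_integral_desc_fact_unit_interval:
  "((\<lambda>t. desc_fact t N) has_integral
     (\<Sum>j\<le>N. real (N choose j) * (desc_fact x (N - j) * cauchy_number j))) {x..x + 1}"
proof -
  have "((\<lambda>\<theta>. desc_fact \<theta> j) has_integral cauchy_number j) {0..1}" for j
    unfolding cauchy_number_def
    by (intro integrable_integral integrable_continuous_interval continuous_intros)
  then have "((\<lambda>\<theta>. desc_fact (x + \<theta>) N) has_integral
      (\<Sum>j\<le>N. real (N choose j) * (desc_fact x (N - j) * cauchy_number j))) {0..1}"
    unfolding desc_fact_add by (intro has_integral_sum has_integral_mult_right) auto
  \<comment> \<open>Translation by \<open>x\<close> moves the unit interval to [x, x + 1].\<close>
  then have "((\<lambda>\<theta>. desc_fact (x + (- x + \<theta>)) N) has_integral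
      (\<Sum>j\<le>N. real (N choose j) * (desc_fact x (N - j) * cauchy_number j))) {x..x + 1}"
    using has_integral_affinity
      [of "\<lambda>\<theta>. desc_fact (x + \<theta>) N" _ 0 1 1 "- x"]
    by (simp add: image_affinity_cbox add.commute)
  then show ?thesis by simp
qed

text \<open>Associativity of binomial convolution: sum over \<open>r = j + i\<close> and factor the
  trinomial coefficient in the other way.\<close>

lemma sum_binomial_trinomial_reindex:
  fixes g :: "nat \<Rightarrow> nat \<Rightarrow> real"
  shows "(\<Sum>j\<le>N. real (N choose j) * (\<Sum>i\<le>N - j. real ((N - j) choose i) * g j i))
      = (\<Sum>r\<le>N. real (N choose r) * (\<Sum>j\<le>r. real (r choose j) * g j (r - j)))"
proof -
  define h where "h j i = real (N choose j) * (real ((N - j) choose i) * g j i)" for j i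
  have "(\<Sum>j\<le>N. real (N choose j) * (\<Sum>i\<le>N - j. real ((N - j) choose i) * g j i))
      = (\<Sum>(j, i)\<in>Sigma {..N} (\<lambda>j. {..N - j}). h j i)"
    by (subst sum.Sigma [symmetric]) (auto simp: h_def sum_distrib_left)
  also have "Sigma {..N} (\<lambda>j. {..N - j}) = {(j, i). j + i \<le> N}"
    by auto
  also have "(\<Sum>(j, i)\<in>\<dots>. h j i) = (\<Sum>r\<le>N. \<Sum>j\<le>r. h j (r - j))"
    by (rule sum.triangle_reindex_eq)
  also have "\<dots> = (\<Sum>r\<le>N. real (N choose r) * (\<Sum>j\<le>r. real (r choose j) * g j (r - j)))"
    unfolding sum_distrib_left
  proof (intro sum.cong refl)
    fix r j assume "r \<in> {..N}" "j \<in> {..r}"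
    then have "real (N choose r) * real (r choose j) = real (N choose j) * real ((N - j) choose (r - j))"
      by (simp only: atMost_iff choose_mult flip: of_nat_mult)
    then show "h j (r - j) = real (N choose r) * (real (r choose j) * g j (r - j))"
      by (simp add: h_def flip: mult.assoc)
  qed
  finally show ?thesis .
qed

text \<open>Differencing commutes with differentiation, so the left side for \<open>Suc m\<close> is
  the integral over [x, x + 1] of the left side for \<open>m\<close>. Integrating the induction
  hypothesis term by term convolves once more with the Cauchy numbers.\<close>

lemma fwd_diff_funpow_antideriv_eq_cauchy_conv:
  fixes P :: "nat \<Rightarrow> real \<Rightarrow> real"
  assumes deriv: "\<And>i x. (P (Suc i) has_real_derivative P i x) (at x)"
    and P0: "\<And>x. P 0 x = desc_fact x N"
  shows "(fwd_diff ^^ m) (P m) x = (\<Sum>j\<le>N. real (N choose j) * (cauchy_conv m j * desc_fact x (N - j)))"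
proof (induction m arbitrary: x)
  case 0
  have "(\<Sum>j\<le>N. real (N choose j) * (cauchy_conv 0 j * desc_fact x (N - j)))
      = (\<Sum>j\<le>N. if j = 0 then desc_fact x N else 0)"
    by (intro sum.cong) auto
  then show ?case by (simp add: P0)
next
  case (Suc m)
  have "((fwd_diff ^^ m) (P m) has_integral
      (fwd_diff ^^ m) (P (Suc m)) (x + 1) - (fwd_diff ^^ m) (P (Suc m)) x) {x..x + 1}"
    by (intro fundamental_theorem_of_calculus)
      (auto intro!: has_field_derivative_at_within fwd_diff_funpow_has_real_derivative deriv
        simp flip: has_real_derivative_iff_has_vector_derivative)
  then have int: "((fwd_diff ^^ m) (P m) has_integral (fwd_diff ^^ Suc m) (P (Suc m)) x) {x..x + 1}"
    by (simp add: fwd_diff_def)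
  have "((fwd_diff ^^ m) (P m) has_integral
      (\<Sum>j\<le>N. real (N choose j) * (cauchy_conv m j *
        (\<Sum>i\<le>N - j. real ((N - j) choose i) * (desc_fact x (N - j - i) * cauchy_number i))))) {x..x + 1}"
    unfolding Suc [THEN ext]
    by (intro has_integral_sum has_integral_mult_right has_integral_desc_fact_unit_interval) auto
  with int have "(fwd_diff ^^ Suc m) (P (Suc m)) x
      = (\<Sum>j\<le>N. real (N choose j) * (cauchy_conv m j *
        (\<Sum>i\<le>N - j. real ((N - j) choose i) * (desc_fact x (N - j - i) * cauchy_number i))))"
    by (rule has_integral_unique)
  also have "\<dots> = (\<Sum>j\<le>N. real (N choose j) * (\<Sum>i\<le>N - j. real ((N - j) choose i) *
      (cauchy_conv m j * desc_fact x (N - (j + i)) * cauchy_number i)))"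
    by (simp add: sum_distrib_left mult_ac)
  also have "\<dots> = (\<Sum>r\<le>N. real (N choose r) * (\<Sum>j\<le>r. real (r choose j) *
      (cauchy_conv m j * desc_fact x (N - (j + (r - j))) * cauchy_number (r - j))))"
    by (rule sum_binomial_trinomial_reindex)
  also have "\<dots> = (\<Sum>r\<le>N. real (N choose r) * (cauchy_conv (Suc m) r * desc_fact x (N - r)))"
  proof (intro sum.cong refl arg_cong2 [where f = "(*)"])
    fix r
    \<comment> \<open>The recursion of \<open>cauchy_conv\<close> carries the Cauchy number at the
      summation index, hence the reversal \<open>j\<close> to \<open>r - j\<close>.\<close>
    have "(\<Sum>j\<le>r. real (r choose j) *
        (cauchy_conv m j * desc_fact x (N - (j + (r - j))) * cauchy_number (r - j)))
        = (\<Sum>j\<le>r. real (r choose (r - j)) *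
        (cauchy_conv m (r - j) * desc_fact x (N - r) * cauchy_number j))"
      by (subst sum.nat_diff_reindex [symmetric, of _ "Suc r", simplified lessThan_Suc_atMost])
        (auto intro!: sum.cong)
    also have "\<dots> = cauchy_conv (Suc m) r * desc_fact x (N - r)"
      by (auto simp: sum_distrib_left mult_ac binomial_symmetric [symmetric] intro!: sum.cong)
    finally show "(\<Sum>j\<le>r. real (r choose j) *
        (cauchy_conv m j * desc_fact x (N - (j + (r - j))) * cauchy_number (r - j)))
        = cauchy_conv (Suc m) r * desc_fact x (N - r)" .
  qed
  finally show ?case .
qed

lemma fwd_diff_funpow_antideriv_at_0:
  fixes P :: "nat \<Rightarrow> real \<Rightarrow> real"
  assumes "\<And>i x. (P (Suc i) has_real_derivative P i x) (at x)" "\<And>x. P 0 x = desc_fact x N"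
  shows "(fwd_diff ^^ m) (P m) 0 = cauchy_conv m N"
proof -
  have "(fwd_diff ^^ m) (P m) 0
      = (\<Sum>j\<le>N. real (N choose j) * (cauchy_conv m j * desc_fact 0 (N - j)))"
    using assms by (rule fwd_diff_funpow_antideriv_eq_cauchy_conv)
  also have "\<dots> = (\<Sum>j\<le>N. if j = N then cauchy_conv m N else 0)"
    using desc_fact_of_nat_eq_0 [of 0] by (intro sum.cong) auto
  finally show ?thesis by simp
qed

section \<open>Sums over tuples\<close>

lemma tuples_0: "tuples 0 n = (if n = 0 then {\<lambda>_. undefined} else {})"
  by (auto simp: tuples_def)

lemma sum_tuples_Suc:
  fixes g :: "(nat \<Rightarrow> nat) \<Rightarrow> real"
  shows "(\<Sum>k\<in>tuples (Suc m) n. g k) = (\<Sum>a\<le>n. \<Sum>k\<in>tuples m (n - a). g (k(Suc m := a)))"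
proof -
  have "(\<Sum>k\<in>tuples (Suc m) n. g k)
      = (\<Sum>(a, k)\<in>Sigma {..n} (\<lambda>a. tuples m (n - a)). g (k(Suc m := a)))"
  \<comment> \<open>The last coordinate is split off; resetting it to \<open>undefined\<close> keeps
    the remaining tuple extensional on \<open>{1..m}\<close>.\<close>
  proof (rule sum.reindex_bij_witness
      [where i = "\<lambda>(a, k). k(Suc m := a)" and j = "\<lambda>k. (k (Suc m), k(Suc m := undefined))"])
    fix k assume "k \<in> tuples (Suc m) n"
    then have k: "\<And>i. i \<notin> {1..Suc m} \<Longrightarrow> k i = undefined" "(\<Sum>i=1..m. k i) + k (Suc m) = n"
      by (auto simp: tuples_def PiE_iff extensional_def)
    have "(\<Sum>i=1..m. (k(Suc m := undefined)) i) = (\<Sum>i=1..m. k i)"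
      by (intro sum.cong) auto
    then show "(k (Suc m), k(Suc m := undefined)) \<in> Sigma {..n} (\<lambda>a. tuples m (n - a))"
      using k by (auto simp: tuples_def PiE_iff extensional_def)
  next
    fix p assume "p \<in> Sigma {..n} (\<lambda>a. tuples m (n - a))"
    then obtain a k where p: "p = (a, k)" "a \<le> n" "k \<in> tuples m (n - a)"
      by auto
    then have k: "\<And>i. i \<notin> {1..m} \<Longrightarrow> k i = undefined" "(\<Sum>i=1..m. k i) = n - a"
      by (auto simp: tuples_def PiE_iff extensional_def)
    show "(\<lambda>k. (k (Suc m), k(Suc m := undefined))) ((\<lambda>(a, k). k(Suc m := a)) p) = p"
      using k(1) [of "Suc m"] by (auto simp: p)
    have "(\<Sum>i=1..m. (k(Suc m := a)) i) = (\<Sum>i=1..m. k i)"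
      by (intro sum.cong) auto
    then show "(\<lambda>(a, k). k(Suc m := a)) p \<in> tuples (Suc m) n"
      using k p(1,2) by (auto simp: tuples_def PiE_iff extensional_def)
  qed auto
  then show ?thesis
    by (simp add: sum.Sigma finite_tuples)
qed

lemma multinomial_Suc:
  assumes "a \<le> n"
  shows "multinomial (Suc m) n (k(Suc m := a)) = real (n choose a) * multinomial m (n - a) k"
proof -
  have "(\<Prod>i=1..m. fact ((k(Suc m := a)) i)) = (\<Prod>i=1..m. fact (k i) :: real)"
    by (intro prod.cong) auto
  then show ?thesis
    using assms by (simp add: multinomial_def binomial_fact)
qed

text \<open>Vandermonde in weighted form: choosing \<open>a\<close> out of \<mu> and
  \<open>b\<close> out of \<open>n\<close> elements chooses \<open>a + b\<close> out of their union.
  The induction needs arbitrary \<open>h\<close>, as Pascal's rule replaces \<open>h r\<close> by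
  \<open>h r + h (Suc r)\<close>.\<close>

lemma sum_binomial_sum_binomial:
  fixes h :: "nat \<Rightarrow> real"
  shows "(\<Sum>a\<le>\<mu>. real (\<mu> choose a) * (\<Sum>b\<le>n. real (n choose b) * h (a + b)))
      = (\<Sum>r\<le>\<mu> + n. real ((\<mu> + n) choose r) * h r)"
proof (induction \<mu> arbitrary: h)
  case (Suc \<mu>)
  have "(\<Sum>a\<le>Suc \<mu>. real (Suc \<mu> choose a) * (\<Sum>b\<le>n. real (n choose b) * h (a + b)))
      = (\<Sum>a\<le>\<mu>. real (\<mu> choose a) * (\<Sum>b\<le>n. real (n choose b) * (h (a + b) + h (Suc (a + b)))))"
    unfolding sum_binomial_Suc by (simp add: distrib_left sum.distrib)
  also have "\<dots> = (\<Sum>r\<le>\<mu> + n. real ((\<mu> + n) choose r) * (h r + h (Suc r)))"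
    by (rule Suc)
  also have "\<dots> = (\<Sum>r\<le>Suc (\<mu> + n). real (Suc (\<mu> + n) choose r) * h r)"
    by (rule sum_binomial_Suc [symmetric])
  finally show ?case by simp
qed simp

text \<open>Splitting the last coordinates \<open>a\<close> and \<open>b\<close> off both tuples
  leaves the same sum for \<mu> - a and n - b. What remains depends on \<open>a + b\<close> only, so
  the two binomial sums merge into one step of the convolution.\<close>

lemma sum_tuples_cauchy_number:
  "(\<Sum>l\<in>tuples m \<mu>. multinomial m \<mu> l *
      (\<Sum>k\<in>tuples m n. multinomial m n k * (\<Prod>i=1..m. cauchy_number (k i + l i))))
    = cauchy_conv m (\<mu> + n)"
proof (induction m arbitrary: \<mu> n)
  case 0
  then show ?case by (simp add: tuples_0 multinomial_def)
next
  case (Suc m)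
  have prod: "(\<Prod>i=1..Suc m. cauchy_number ((k(Suc m := b)) i + (l(Suc m := a)) i))
      = cauchy_number (a + b) * (\<Prod>i=1..m. cauchy_number (k i + l i))" for k l :: "nat \<Rightarrow> nat" and a b
  proof -
    have "(\<Prod>i=1..m. cauchy_number ((k(Suc m := b)) i + (l(Suc m := a)) i))
        = (\<Prod>i=1..m. cauchy_number (k i + l i))"
      by (intro prod.cong) auto
    then show ?thesis by (simp add: add.commute mult.commute)
  qed
  have "(\<Sum>l\<in>tuples (Suc m) \<mu>. multinomial (Suc m) \<mu> l *
      (\<Sum>k\<in>tuples (Suc m) n. multinomial (Suc m) n k * (\<Prod>i=1..Suc m. cauchy_number (k i + l i))))
      = (\<Sum>a\<le>\<mu>. \<Sum>l\<in>tuples m (\<mu> - a). real (\<mu> choose a) * multinomial m (\<mu> - a) l *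
          (\<Sum>b\<le>n. \<Sum>k\<in>tuples m (n - b). real (n choose b) * multinomial m (n - b) k *
            (cauchy_number (a + b) * (\<Prod>i=1..m. cauchy_number (k i + l i)))))"
    unfolding sum_tuples_Suc prod by (intro sum.cong refl arg_cong2 [where f = "(*)"] multinomial_Suc) auto
  also have "\<dots> = (\<Sum>a\<le>\<mu>. real (\<mu> choose a) * (\<Sum>b\<le>n. real (n choose b) * (cauchy_number (a + b) *
      (\<Sum>l\<in>tuples m (\<mu> - a). multinomial m (\<mu> - a) l *
        (\<Sum>k\<in>tuples m (n - b). multinomial m (n - b) k * (\<Prod>i=1..m. cauchy_number (k i + l i)))))))"
    unfolding sum_distrib_left
    by (intro sum.cong refl, subst sum.swap) (simp add: mult_ac)
  also have "\<dots> = (\<Sum>a\<le>\<mu>. real (\<mu> choose a) * (\<Sum>b\<le>n. real (n choose b) *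
      (cauchy_number (a + b) * cauchy_conv m (\<mu> + n - (a + b)))))"
    unfolding Suc by (intro sum.cong refl arg_cong2 [where f = "(*)"] arg_cong [where f = "cauchy_conv m"]) auto
  also have "\<dots> = cauchy_conv (Suc m) (\<mu> + n)"
    by (simp add: sum_binomial_sum_binomial [of _ _ "\<lambda>r. cauchy_number r * cauchy_conv m (\<mu> + n - r)"])
  finally show ?case .
qed

theorem theorem1:
  fixes n \<mu> m :: nat
  assumes "m \<ge> 1"
  shows "(\<Sum>l\<in>tuples m \<mu>. multinomial m \<mu> l *
            (\<Sum>k\<in>tuples m n. multinomial m n k * (\<Prod>i=1..m. cauchy_number (k i + l i))))
          = integral {0..real m} (\<lambda>\<theta>. desc_fact \<theta> (\<mu> + n) * rho m \<theta>)
       \<and> integral {0..real m} (\<lambda>\<theta>. desc_fact \<theta> (\<mu> + n) * rho m \<theta>)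
          = (\<Sum>k=0..\<mu> + n. real_of_int (stirling1 (\<mu> + n) k) * real (Stirling (m + k) m)
                              / real ((m + k) choose m))"
proof -
  let ?P = "desc_fact_antideriv (\<mu> + n)"
  have "integral {0..real m} (\<lambda>\<theta>. desc_fact \<theta> (\<mu> + n) * rho m \<theta>) = (fwd_diff ^^ m) (?P m) 0"
    using integral_rho_eq_fwd_diff [of ?P m] assms
    by (simp add: desc_fact_antideriv_has_real_derivative desc_fact_antideriv_0)
  then show ?thesis
    \<comment> \<open>Read backwards, \<open>fwd_diff_funpow_antideriv_at_0\<close> turns the
      convolution into the difference of \<open>?P m\<close> at 0, which then becomes the Stirling
      sum, as does the integral.\<close>
    by (simp only: sum_tuples_cauchy_number fwd_diff_funpow_desc_fact_antideriv_at_0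
        fwd_diff_funpow_antideriv_at_0 [of ?P, OF desc_fact_antideriv_has_real_derivative
          desc_fact_antideriv_0, symmetric] simp_thms)
qed

end
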